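(* Let $Y$ be a real Banach space and let $X$ be a subspace of $Y$ which is an almost isometric ideal in $Y$. Then there exists a Hahn-Banach extension operator $\varphi: X^{*}\to Y^{*}$ such that for every $\varepsilon>0$, every finite-dimensional subspace $E\subset Y$ and every finite-dimensional subspace $F\subset X^{*}$ there exists a linear operator $T:E\to X$ such that (1) $Te=e$ for all $e\in X\cap E$; (2) $(1+\varepsilon)^{-1}\|e\|\le\|Te\|\le(1+\varepsilon)\|e\|$ for all $e\in E$; (3) $\varphi(f^{*})(e)=f^{*}(Te)$ for all $e\in E$ and all $f^{*}\in F$.
   Context: All Banach spaces are real. A subspace $X$ (not necessarily closed) of a Banach space $Y$ is an almost isometric ideal (ai-ideal) in $Y$ if for every $\varepsilon>0$ and every finite-dimensional subspace $E\subset Y$ there exists a linear operator $T:E\to X$ such that $Te=e$ for all $e\in X\cap E$ and $(1+\varepsilon)^{-1}\|e\|\le\|Te\|\le(1+\varepsilon)\|e\|$ for all $e\in E$. A linear operator $\varphi:X^{*}\to Y^{*}$ is a Hahn-Banach extension operator if $\varphi(x^{*})(x)=x^{*}(x)$ and $\|\varphi(x^{*})\|=\|x^{*}\|$ for all $x\in X$ and $x^{*}\in X^{*}$. *)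

theory Defs
  imports "HOL-Analysis.Analysis" "HOL-Library.Function_Algebras"
begin

text \<open>Pointwise scalar multiplication, so that spaces of functionals on a subspace are linear
  subspaces of a function space and the library notions \<open>subspace\<close> and \<open>span\<close> apply to them.\<close>

instantiation "fun" :: (type, real_vector) real_vector
begin

definition scaleR_fun :: "real \<Rightarrow> ('a \<Rightarrow> 'b) \<Rightarrow> 'a \<Rightarrow> 'b"
  where "scaleR_fun c f = (\<lambda>x. c *\<^sub>R f x)"

instance
  by standard (auto simp: scaleR_fun_def fun_eq_iff scaleR_add_right scaleR_add_left)

end

definition finite_dim_subspace :: "'a::real_vector set \<Rightarrow> bool"
  where "finite_dim_subspace E \<longleftrightarrow> subspace E \<and> (\<exists>B. finite B \<and> E \<subseteq> span B)"

definition linear_on :: "'a::real_vector set \<Rightarrow> ('a \<Rightarrow> 'b::real_vector) \<Rightarrow> bool"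
  where "linear_on S f \<longleftrightarrow>
    (\<forall>x\<in>S. \<forall>y\<in>S. f (x + y) = f x + f y) \<and> (\<forall>c. \<forall>x\<in>S. f (c *\<^sub>R x) = c *\<^sub>R f x)"

text \<open>The dual \<open>X\<^sup>*\<close> of a subspace \<open>X\<close>, with respect to the norm inherited from the ambient space.
  A functional on \<open>X\<close> is represented by the function on the ambient space that extends it by \<open>0\<close>
  (in general not linearly), so distinct elements of \<open>dual_space X\<close> are distinct functionals on \<open>X\<close>,
  and the vector space operations of \<open>X\<^sup>*\<close> are the pointwise ones.\<close>

definition dual_space :: "'a::real_normed_vector set \<Rightarrow> ('a \<Rightarrow> real) set"
  where "dual_space X =
    {f. linear_on X f \<and> (\<exists>C. \<forall>x\<in>X. \<bar>f x\<bar> \<le> C * norm x) \<and> (\<forall>x. x \<notin> X \<longrightarrow> f x = 0)}"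

text \<open>The operator norm on \<open>X\<^sup>*\<close>: \<open>onorm\<close> with the supremum restricted to \<open>X\<close>. The point
  \<open>x = 0\<close> contributes \<open>0 / 0 = 0\<close>.\<close>

definition dual_norm :: "'a::real_normed_vector set \<Rightarrow> ('a \<Rightarrow> real) \<Rightarrow> real"
  where "dual_norm X f = (SUP x\<in>X. \<bar>f x\<bar> / norm x)"

definition ai_ideal :: "'a::real_normed_vector set \<Rightarrow> bool"
  where "ai_ideal X \<longleftrightarrow> subspace X \<and>
    (\<forall>\<epsilon>>0. \<forall>E. finite_dim_subspace E \<longrightarrow>
      (\<exists>T. linear_on E T \<and> T ` E \<subseteq> X \<and> (\<forall>e\<in>X \<inter> E. T e = e) \<and>
        (\<forall>e\<in>E. inverse (1 + \<epsilon>) * norm e \<le> norm (T e) \<and> norm (T e) \<le> (1 + \<epsilon>) * norm e)))"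

definition hahn_banach_extension_operator ::
    "'a::real_normed_vector set \<Rightarrow> (('a \<Rightarrow> real) \<Rightarrow> 'a \<Rightarrow>\<^sub>L real) \<Rightarrow> bool"
  where "hahn_banach_extension_operator X \<phi> \<longleftrightarrow> linear_on (dual_space X) \<phi> \<and>
    (\<forall>f\<in>dual_space X. (\<forall>x\<in>X. blinfun_apply (\<phi> f) x = f x) \<and> norm (\<phi> f) = dual_norm X f)"

end

theory Submission
  imports Defs
begin

text \<open>
  For a finite-dimensional \<open>E\<close> and \<open>\<epsilon> > 0\<close>, an operator \<open>T : E \<rightarrow> X\<close> supplied by the ideal
  property gives the numbers \<open>f (T e)\<close>, a first approximation to \<open>\<phi> f e\<close>. As \<open>E\<close> grows and \<open>\<epsilon>\<close>
  shrinks these numbers stay bounded, so by Tychonoff's theorem they have a cluster point \<open>\<psi>\<close>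
  (\<open>limit_of_evaluations\<close>). Every closed condition that holds for all evaluations from some
  \<open>E\<close> and \<open>\<epsilon>\<close> on passes to \<open>\<psi>\<close>. Linearity in both arguments, agreement with \<open>f\<close> on \<open>X\<close> and the
  bound by \<open>(1 + \<epsilon>) * dual_norm X f * norm e\<close> are such conditions, so \<open>\<phi> f = \<psi> (f, _)\<close> is a
  Hahn-Banach extension operator (\<open>limit_extension_operator\<close>).

  At this point \<open>\<phi> f e = f (T e)\<close> holds only approximately, on finitely many pairs at a time. The
  error is removed by adding a small operator to \<open>T\<close> (\<open>exact_duality_correction\<close>). A
  finite-dimensional \<open>F\<close> of functionals on \<open>X\<close> has an interpolation formula \<open>f = (\<Sum>i. f (p i) *\<^sub>R g i)\<close>
  with \<open>p i \<in> X\<close> and \<open>g i \<in> F\<close>. Put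
  \<open>S e = (\<Sum>i. (\<phi> (g i) e - g i (T e)) *\<^sub>R p i)\<close>.
  By linearity of the error in \<open>f\<close>, \<open>f (S e) = \<phi> f e - f (T e)\<close> for every \<open>f \<in> F\<close>, so \<open>T + S\<close>
  represents \<open>\<phi>\<close> exactly. On \<open>X \<inter> E\<close> the error vanishes, since \<open>T\<close> is the identity there and
  \<open>\<phi> f\<close> extends \<open>f\<close>; hence \<open>S\<close> vanishes there without any choice of a complement. Finally \<open>S\<close> is
  small in norm once the error is small at the vectors of a basis of \<open>E\<close>, because coordinates on
  \<open>E\<close> are bounded, and a small perturbation of an almost isometry is an almost isometry.
\<close>

section \<open>Linear algebra and coordinates\<close>

lemma linear_on_sum:
  assumes S: "subspace S" and f: "linear_on S f" and v: "\<And>i. i \<in> I \<Longrightarrow> v i \<in> S"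
  shows "f (\<Sum>i\<in>I. c i *\<^sub>R v i) = (\<Sum>i\<in>I. c i *\<^sub>R f (v i))"
  using v
proof (induction I rule: infinite_finite_induct)
  case (insert i I)
  have "(\<Sum>i\<in>I. c i *\<^sub>R v i) \<in> S" "c i *\<^sub>R v i \<in> S"
    using insert.prems S by (auto intro!: subspace_sum subspace_scale)
  then show ?case
    using insert f by (simp add: linear_on_def)
next
  case (infinite I)
  have "f (0 *\<^sub>R 0) = 0 *\<^sub>R f 0"
    using f subspace_0[OF S] unfolding linear_on_def by blast
  then show ?case using infinite by simp
next
  case empty
  have "f (0 *\<^sub>R 0) = 0 *\<^sub>R f 0"
    using f subspace_0[OF S] unfolding linear_on_def by blast
  then show ?case by simp
qed

lemma linear_on_subset: "linear_on S f \<Longrightarrow> R \<subseteq> S \<Longrightarrow> linear_on R f"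
  unfolding linear_on_def by blast

lemma finite_dim_subspace_basis:
  assumes "finite_dim_subspace E"
  obtains B where "finite B" "B \<subseteq> E" "independent B" "span B = E"
proof -
  obtain C where C: "subspace E" "finite C" "E \<subseteq> span C"
    using assms unfolding finite_dim_subspace_def by blast
  obtain B where B: "B \<subseteq> E" "independent B" "E \<subseteq> span B"
    by (rule maximal_independent_subset)
  have "finite B"
    using independent_span_bound[OF C(2) B(2)] B(1) C(3) by blast
  moreover have "span B = E"
    using B span_minimal[OF B(1) C(1)] by blast
  ultimately show ?thesis using B that by blast
qed

text \<open>Finitely many evaluations determine the elements of a finite-dimensional space of functions.
  Adding a function \<open>b\<close> to \<open>B\<close>, interpolation at the old points is a projection \<open>P\<close> onto \<open>span B\<close>,
  and the new span is \<open>span B\<close> plus the line through the residual \<open>b - P b\<close>; if that residual is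
  nonzero, the coefficient along it is read off at any point \<open>x\<close> where it does not vanish. Indexing
  nodes by \<open>B\<close> rather than by the points themselves lets \<open>x\<close> coincide with an old node.\<close>

lemma interpolation_in_function_space:
  fixes B :: "('a \<Rightarrow> real) set"
  assumes "finite B"
  shows "\<exists>p g. (\<forall>b\<in>B. g b \<in> span B) \<and> (\<forall>f\<in>span B. f = (\<Sum>b\<in>B. f (p b) *\<^sub>R g b))"
  using assms
proof (induction B)
  case empty
  then show ?case by auto
next
  case (insert b B)
  then obtain p g where g: "\<And>c. c \<in> B \<Longrightarrow> g c \<in> span B"
    and pg: "\<And>f. f \<in> span B \<Longrightarrow> f = (\<Sum>c\<in>B. f (p c) *\<^sub>R g c)"
    by metis
  define P where "P f = (\<Sum>c\<in>B. f (p c) *\<^sub>R g c)" for f :: "'a \<Rightarrow> real"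
  have P_span: "P f \<in> span B" for f
    unfolding P_def by (intro span_sum span_scale g)
  have P_id: "P f = f" if "f \<in> span B" for f
    using pg[OF that] by (simp add: P_def)
  have P_comb: "P (h + k *\<^sub>R f) = P h + k *\<^sub>R P f" for h f k
    unfolding P_def
    by (simp add: scaleR_fun_def[of k f] algebra_simps sum.distrib scaleR_sum_right)
  define r where "r = b - P b"
  have r_span: "r \<in> span (insert b B)"
    unfolding r_def
  proof (rule span_diff)
    show "P b \<in> span (insert b B)"
      using P_span[of b] span_mono[of B "insert b B"] by blast
  qed (simp add: span_base)
  have rem: "\<exists>k. f = P f + k *\<^sub>R r" if f: "f \<in> span (insert b B)" for f
  proof -
    obtain k where k: "f - k *\<^sub>R b \<in> span B"
      using f unfolding span_insert by blast
    have "P f = P ((f - k *\<^sub>R b) + k *\<^sub>R b)" by simp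
    also have "\<dots> = (f - k *\<^sub>R b) + k *\<^sub>R P b" by (simp only: P_comb P_id[OF k])
    finally have "f = P f + k *\<^sub>R r" by (simp add: r_def algebra_simps)
    then show ?thesis by blast
  qed
  show ?case
  proof (cases "r = 0")
    case True
    have "f = (\<Sum>c\<in>insert b B. f (p c) *\<^sub>R (g(b := 0)) c)" if "f \<in> span (insert b B)" for f
    proof -
      have "f = P f" using rem[OF that] True by auto
      also have "\<dots> = (\<Sum>c\<in>B. f (p c) *\<^sub>R (g(b := 0)) c)"
        unfolding P_def using insert.hyps(2) by (intro sum.cong) auto
      finally show ?thesis using insert.hyps by simp
    qed
    moreover have "\<forall>c\<in>insert b B. (g(b := 0)) c \<in> span (insert b B)"
      using g span_mono[of B "insert b B"] by (auto simp: span_zero)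
    ultimately show ?thesis by blast
  next
    case False
    then obtain x where x: "r x \<noteq> 0" by (auto simp: fun_eq_iff)
    \<comment> \<open>With \<open>s x = 1\<close>, the coefficient of \<open>s\<close> in \<open>f\<close> is \<open>f x - P f x\<close>. Its second part is a
      combination of the old values \<open>f (p c)\<close> and is absorbed into the \<open>g c\<close>.\<close>
    define s where "s = inverse (r x) *\<^sub>R r"
    define g' where "g' = (\<lambda>c. g c - g c x *\<^sub>R s)(b := s)"
    define p' where "p' = p(b := x)"
    have s_span: "s \<in> span (insert b B)"
      unfolding s_def by (intro span_scale r_span)
    have "f = (\<Sum>c\<in>insert b B. f (p' c) *\<^sub>R g' c)" if f: "f \<in> span (insert b B)" for f
    proof -
      obtain k where k: "f = P f + k *\<^sub>R r" using rem[OF f] by blast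
      have "f x = P f x + k * r x"
        by (subst k) (simp add: scaleR_fun_def)
      then have "k = (f x - P f x) * inverse (r x)" using x by (simp add: field_simps)
      then have fs: "f = P f + (f x - P f x) *\<^sub>R s" using k by (simp add: s_def)
      have ev: "(\<Sum>c\<in>A. h c *\<^sub>R u c) x = (\<Sum>c\<in>A. h c * u c x)"
        for A :: "('a \<Rightarrow> real) set" and h and u :: "_ \<Rightarrow> 'a \<Rightarrow> real"
        by (induction A rule: infinite_finite_induct) (auto simp: scaleR_fun_def)
      have "(\<Sum>c\<in>insert b B. f (p' c) *\<^sub>R g' c)
          = f x *\<^sub>R s + (\<Sum>c\<in>B. f (p' c) *\<^sub>R g' c)"
        using insert.hyps by (simp add: p'_def g'_def)
      also have "(\<Sum>c\<in>B. f (p' c) *\<^sub>R g' c) = (\<Sum>c\<in>B. f (p c) *\<^sub>R (g c - g c x *\<^sub>R s))"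
        unfolding p'_def g'_def using insert.hyps(2) by (intro sum.cong) auto
      also have "\<dots> = P f - P f x *\<^sub>R s"
        by (simp add: P_def ev scaleR_diff_right sum_subtractf scaleR_sum_left)
      finally have "(\<Sum>c\<in>insert b B. f (p' c) *\<^sub>R g' c) = P f + (f x *\<^sub>R s - P f x *\<^sub>R s)"
        by (simp only: add_diff_eq add.commute[of "P f" "f x *\<^sub>R s"])
      then show ?thesis using fs by (simp only: scaleR_diff_left)
    qed
    moreover have "\<forall>c\<in>insert b B. g' c \<in> span (insert b B)"
      using g span_mono[of B "insert b B"] s_span
      unfolding g'_def by (auto intro!: span_diff span_scale)
    ultimately show ?thesis by blast
  qed
qed

lemma compact_product_interval:
  fixes C :: "'a \<Rightarrow> real"
  shows "compact {h. \<forall>z. \<bar>h z\<bar> \<le> C z}"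
proof -
  have "compactin (product_topology (\<lambda>z. euclidean) UNIV) (PiE UNIV (\<lambda>z. {- C z..C z}))"
    unfolding compactin_PiE by simp
  moreover have "PiE UNIV (\<lambda>z. {- C z..C z}) = {h. \<forall>z. \<bar>h z\<bar> \<le> C z}"
    by (auto simp: PiE_def Pi_def abs_le_iff minus_le_iff)
  ultimately show ?thesis
    by (simp add: euclidean_product_topology)
qed

text \<open>The equivalence of the norm on \<open>span B\<close> with the maximum norm of the coordinates: on the
  compact set of coordinate families of maximum norm 1 the norm attains a minimum, which
  independence makes positive. Coordinates outside \<open>B\<close> do not affect the sum, so they are merely
  confined to \<open>[-1, 1]\<close>, which keeps the set compact.\<close>

lemma coordinates_bounded:
  fixes B :: "'a::real_normed_vector set"
  assumes B: "finite B" "independent B"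
  shows "\<exists>K>0. \<forall>c. \<forall>b\<in>B. \<bar>c b\<bar> \<le> K * norm (\<Sum>b\<in>B. c b *\<^sub>R b)"
proof (cases "B = {}")
  case True
  then show ?thesis by (intro exI[of _ 1]) simp
next
  case False
  define N where "N c = norm (\<Sum>b\<in>B. c b *\<^sub>R b)" for c
  define S where "S = {c :: 'a \<Rightarrow> real. \<forall>z. \<bar>c z\<bar> \<le> 1} \<inter> (\<Union>b\<in>B. {c. \<bar>c b\<bar> = 1})"
  have "compact S"
    unfolding S_def
    by (intro compact_Int_closed compact_product_interval closed_UN B(1) ballI closed_Collect_eq
        continuous_intros continuous_on_product_coordinates)
  moreover have "(\<lambda>_. 1) \<in> S" using False by (auto simp: S_def)
  moreover have "continuous_on S N"
    unfolding N_def
    by (rule continuous_on_subset[of UNIV])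
      (intro continuous_intros continuous_on_product_coordinates, simp)
  ultimately obtain c0 where c0: "c0 \<in> S" "\<And>c. c \<in> S \<Longrightarrow> N c0 \<le> N c"
    using continuous_attains_inf[of S N] by blast
  have pos: "N c0 > 0"
  proof (rule ccontr)
    assume "\<not> N c0 > 0"
    then have "(\<Sum>b\<in>B. c0 b *\<^sub>R b) = 0" by (simp add: N_def)
    then have "\<forall>b\<in>B. c0 b = 0"
      using independentD[OF B(2) B(1) subset_refl] by blast
    then show False using c0(1) by (auto simp: S_def)
  qed
  have "\<bar>c b\<bar> \<le> inverse (N c0) * N c" if b: "b \<in> B" for c b
  proof -
    define M where "M = Max ((\<lambda>b. \<bar>c b\<bar>) ` B)"
    have M: "\<bar>c b\<bar> \<le> M" if "b \<in> B" for b
      using that B(1) by (simp add: M_def)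
    have "M \<in> (\<lambda>b. \<bar>c b\<bar>) ` B"
      unfolding M_def using B(1) False by (intro Max_in) auto
    then obtain b1 where b1: "b1 \<in> B" "M = \<bar>c b1\<bar>" by auto
    show ?thesis
    proof (cases "M = 0")
      case True
      then have "c b = 0" using M[OF b] by simp
      then show ?thesis using pos by (simp add: N_def)
    next
      case False
      then have Mpos: "M > 0" using b1 by auto
      define d where "d = (\<lambda>z. if z \<in> B then c z / M else 0)"
      have "d \<in> S"
        unfolding S_def d_def using M Mpos b1 by auto
      then have "N c0 \<le> N d" by (rule c0(2))
      also have "(\<Sum>b\<in>B. d b *\<^sub>R b) = inverse M *\<^sub>R (\<Sum>b\<in>B. c b *\<^sub>R b)"
        unfolding scaleR_sum_right d_def by (intro sum.cong) (auto simp: divide_inverse_commute)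
      then have "N d = inverse M * N c" using Mpos by (simp add: N_def)
      finally have "M \<le> inverse (N c0) * N c" using Mpos pos by (simp add: field_simps)
      then show ?thesis using M[OF b] by simp
    qed
  qed
  then show ?thesis
    using pos unfolding N_def by (intro exI[of _ "inverse (norm (\<Sum>b\<in>B. c0 b *\<^sub>R b))"]) simp
qed

section \<open>The dual space of a subspace\<close>

lemma subspace_dual_space: "subspace (dual_space X)"
proof (rule subspaceI)
  show "0 \<in> dual_space X"
    by (auto simp: dual_space_def linear_on_def intro: exI[of _ 0])
next
  fix f g assume "f \<in> dual_space X" "g \<in> dual_space X"
  then obtain C D where "linear_on X f" "linear_on X g" "\<forall>x\<in>X. \<bar>f x\<bar> \<le> C * norm x"
    "\<forall>x\<in>X. \<bar>g x\<bar> \<le> D * norm x" "\<forall>x. x \<notin> X \<longrightarrow> f x = 0 \<and> g x = 0"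
    unfolding dual_space_def by auto
  moreover from this have "\<forall>x\<in>X. \<bar>f x + g x\<bar> \<le> (C + D) * norm x"
    by (fastforce simp: algebra_simps intro: order_trans[OF abs_triangle_ineq])
  ultimately show "f + g \<in> dual_space X"
    unfolding dual_space_def linear_on_def
    by (auto simp: algebra_simps intro!: exI[of _ "C + D"])
next
  fix f and c :: real assume "f \<in> dual_space X"
  then obtain C where "linear_on X f" "\<forall>x\<in>X. \<bar>f x\<bar> \<le> C * norm x" "\<forall>x. x \<notin> X \<longrightarrow> f x = 0"
    unfolding dual_space_def by auto
  moreover from this have "\<forall>x\<in>X. \<bar>c * f x\<bar> \<le> (\<bar>c\<bar> * C) * norm x"
    by (auto simp: abs_mult mult.assoc mult_left_mono)
  ultimately show "c *\<^sub>R f \<in> dual_space X"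
    unfolding dual_space_def linear_on_def
    by (auto simp: scaleR_fun_def algebra_simps intro!: exI[of _ "\<bar>c\<bar> * C"])
qed

lemma
  assumes X: "subspace X" and f: "f \<in> dual_space X"
  shows dual_norm_bound: "x \<in> X \<Longrightarrow> \<bar>f x\<bar> \<le> dual_norm X f * norm x"
    and dual_norm_nonneg: "0 \<le> dual_norm X f"
proof -
  obtain C where C: "\<And>x. x \<in> X \<Longrightarrow> \<bar>f x\<bar> \<le> C * norm x"
    using f unfolding dual_space_def by auto
  have "\<bar>f x\<bar> / norm x \<le> max C 0" if "x \<in> X" for x
    using C[OF that] by (cases "x = 0") (auto simp: divide_le_eq le_max_iff_disj)
  then have "bdd_above ((\<lambda>x. \<bar>f x\<bar> / norm x) ` X)" by (auto intro!: bdd_aboveI)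
  then have le: "\<bar>f x\<bar> / norm x \<le> dual_norm X f" if "x \<in> X" for x
    unfolding dual_norm_def using that by (rule cSUP_upper2) auto
  show "0 \<le> dual_norm X f" using le[OF subspace_0[OF X]] by simp
  show "\<bar>f x\<bar> \<le> dual_norm X f * norm x" if "x \<in> X"
    using le[OF that] C[OF that] by (cases "x = 0") (auto simp: divide_le_eq)
qed

lemma dual_norm_least:
  assumes "subspace X" and "0 \<le> C" and "\<And>x. x \<in> X \<Longrightarrow> \<bar>f x\<bar> \<le> C * norm x"
  shows "dual_norm X f \<le> C"
  unfolding dual_norm_def
proof (rule cSUP_least)
  show "X \<noteq> {}" using subspace_0[OF assms(1)] by blast
  show "\<bar>f x\<bar> / norm x \<le> C" if "x \<in> X" for x
    using assms(2) assms(3)[OF that] by (cases "x = 0") (auto simp: divide_le_eq)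
qed

text \<open>Nodes outside \<open>X\<close> may be moved to 0: every functional in the dual space takes the value 0 at
  both places.\<close>

lemma interpolation_in_dual_space:
  fixes X :: "'a::real_normed_vector set"
  assumes X: "subspace X" and F: "finite_dim_subspace F" "F \<subseteq> dual_space X"
  shows "\<exists>(B :: ('a \<Rightarrow> real) set) p g. finite B \<and> p ` B \<subseteq> X \<and> g ` B \<subseteq> F \<and>
    (\<forall>f\<in>F. f = (\<Sum>b\<in>B. f (p b) *\<^sub>R g b))"
proof -
  obtain B where B: "finite B" "span B = F"
    using finite_dim_subspace_basis[OF F(1)] by metis
  obtain p g where g: "\<And>b. b \<in> B \<Longrightarrow> g b \<in> F"
    and pg: "\<And>f. f \<in> F \<Longrightarrow> f = (\<Sum>b\<in>B. f (p b) *\<^sub>R g b)"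
    using interpolation_in_function_space[OF B(1)] unfolding B(2) by metis
  define q where "q b = (if p b \<in> X then p b else 0)" for b
  have q: "q b \<in> X" for b
    using subspace_0[OF X] by (simp add: q_def)
  have fq: "f (q b) = f (p b)" if "f \<in> F" for f b
  proof -
    have f: "f \<in> dual_space X" using that F(2) by blast
    then have "f 0 = 0" using dual_norm_bound[OF X f subspace_0[OF X]] by simp
    then show ?thesis using f by (simp add: q_def dual_space_def)
  qed
  have "f = (\<Sum>b\<in>B. f (q b) *\<^sub>R g b)" if "f \<in> F" for f
    using pg[OF that] by (simp add: fq[OF that])
  then show ?thesis
    using B(1) q g by (intro exI[of _ B] exI[of _ q] exI[of _ g]) auto
qed

section \<open>Limits of almost isometric operators\<close>

definition ai_operator :: "'a::real_normed_vector set \<Rightarrow> real \<Rightarrow> 'a set \<Rightarrow> ('a \<Rightarrow> 'a) \<Rightarrow> bool"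
  where "ai_operator X \<epsilon> E T \<longleftrightarrow> linear_on E T \<and> T ` E \<subseteq> X \<and> (\<forall>e\<in>X \<inter> E. T e = e) \<and>
    (\<forall>e\<in>E. inverse (1 + \<epsilon>) * norm e \<le> norm (T e) \<and> norm (T e) \<le> (1 + \<epsilon>) * norm e)"

lemma ai_operator_mono:
  assumes T: "ai_operator X \<delta> E T" and "0 \<le> \<delta>" "\<delta> \<le> \<epsilon>" "D \<subseteq> E"
  shows "ai_operator X \<epsilon> D T"
proof -
  have "inverse (1 + \<epsilon>) * norm e \<le> inverse (1 + \<delta>) * norm e"
    "(1 + \<delta>) * norm e \<le> (1 + \<epsilon>) * norm e" for e :: 'a
    using assms by (auto intro!: mult_right_mono simp: field_simps)
  then have "inverse (1 + \<epsilon>) * norm e \<le> norm (T e) \<and> norm (T e) \<le> (1 + \<epsilon>) * norm e"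
    if "e \<in> D" for e
    using T that assms(4) unfolding ai_operator_def by (meson order_trans subsetD)
  then show ?thesis
    using T assms(4) linear_on_subset[of E T D] unfolding ai_operator_def by blast
qed

text \<open>Only the values of \<open>h\<close> on functionals in the dual space and vectors in \<open>span B\<close> are
  constrained. With this choice the sets shrink when \<open>B\<close> grows and \<open>\<epsilon>\<close> decreases, so they form a
  filter base along which limits can be taken.\<close>

definition evaluations ::
    "'a::real_normed_vector set \<Rightarrow> 'a set \<Rightarrow> real \<Rightarrow> (('a \<Rightarrow> real) \<times> 'a \<Rightarrow> real) set"
  where "evaluations X B \<epsilon> =
    {h. \<exists>T. ai_operator X \<epsilon> (span B) T \<and> (\<forall>f\<in>dual_space X. \<forall>e\<in>span B. h (f, e) = f (T e))}"

text \<open>Compactness of a product of intervals and the finite intersection property: for finitely many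
  pairs \<open>(B, \<epsilon>)\<close>, one operator on the span of the union with the least \<open>\<epsilon>\<close> serves all of them.\<close>

lemma limit_of_evaluations:
  assumes "ai_ideal X"
  shows "\<exists>\<psi>. \<forall>B \<epsilon>. finite B \<longrightarrow> 0 < \<epsilon> \<longrightarrow> \<psi> \<in> closure (evaluations X B \<epsilon>)"
proof -
  have X: "subspace X" using assms by (simp add: ai_ideal_def)
  \<comment> \<open>The factor 2 bounds \<open>1 + \<delta>\<close>, as only \<open>\<delta> \<le> 1\<close> are used below.\<close>
  define C where "C = (\<lambda>(f, e :: 'a). if f \<in> dual_space X then 2 * (dual_norm X f * norm e) else 0)"
  define K where "K = {h. \<forall>z. \<bar>h z\<bar> \<le> C z}"
  define I where "I = {(B :: 'a set, \<epsilon> :: real). finite B \<and> 0 < \<epsilon>}"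
  define V where "V = (\<lambda>(B, \<epsilon>). closure (evaluations X B \<epsilon>))"
  have "K \<inter> (\<Inter>i\<in>I. V i) \<noteq> {}"
  proof (rule compact_imp_fip_image)
    show "compact K" unfolding K_def by (rule compact_product_interval)
    show "closed (V i)" for i by (simp add: V_def split: prod.split)
  next
    fix J assume J: "finite J" "J \<subseteq> I"
    define A where "A = \<Union> (fst ` J)"
    define \<delta> where "\<delta> = Min (insert 1 (snd ` J))"
    have fA: "finite A" using J by (auto simp: A_def I_def)
    have d: "0 < \<delta>" "\<delta> \<le> 1" using J by (auto simp: \<delta>_def I_def)
    have "finite_dim_subspace (span A)"
      unfolding finite_dim_subspace_def using fA by auto
    then obtain T where T: "ai_operator X \<delta> (span A) T"
      using assms d(1) unfolding ai_ideal_def ai_operator_def by blast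
    define h where "h = (\<lambda>(f, e). if f \<in> dual_space X \<and> e \<in> span A then f (T e) else 0)"
    have "\<bar>h (f, e)\<bar> \<le> C (f, e)" for f e
    proof (cases "f \<in> dual_space X \<and> e \<in> span A")
      case True
      then have "T e \<in> X" "norm (T e) \<le> (1 + \<delta>) * norm e"
        using T unfolding ai_operator_def by auto
      moreover have "(1 + \<delta>) * norm e \<le> 2 * norm e" using d by (intro mult_right_mono) auto
      ultimately have "\<bar>f (T e)\<bar> \<le> dual_norm X f * (2 * norm e)"
        using dual_norm_bound[OF X, of f "T e"] dual_norm_nonneg[OF X, of f] True
        by (meson mult_left_mono order_trans)
      then show ?thesis using True by (simp add: h_def C_def)
    next
      case False
      then show ?thesis
        using dual_norm_nonneg[OF X, of f] by (auto simp: h_def C_def)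
    qed
    then have "h \<in> K" by (auto simp: K_def)
    moreover have "h \<in> V i" if i: "i \<in> J" for i
    proof -
      obtain B \<epsilon> where B: "i = (B, \<epsilon>)" by (cases i)
      have sub: "span B \<subseteq> span A" using i B by (intro span_mono) (force simp: A_def)
      have "\<epsilon> \<in> snd ` J" using i B by force
      then have "\<delta> \<le> \<epsilon>" using J unfolding \<delta>_def by (intro Min_le) auto
      then have "ai_operator X \<epsilon> (span B) T"
        using ai_operator_mono[OF T _ _ sub] d by simp
      then have "h \<in> evaluations X B \<epsilon>"
        using sub unfolding evaluations_def h_def by auto
      then show ?thesis using closure_subset by (auto simp: V_def B)
    qed
    ultimately show "K \<inter> (\<Inter>i\<in>J. V i) \<noteq> {}" by blast
  qed
  then obtain \<psi> where "\<psi> \<in> (\<Inter>i\<in>I. V i)" by blast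
  then show ?thesis unfolding I_def V_def by (intro exI[of _ \<psi>]) auto
qed

lemma limit_of_evaluations_approximates:
  fixes X :: "'a::real_normed_vector set"
  assumes \<psi>: "\<psi> \<in> closure (evaluations X B \<epsilon>)"
    and "finite B" "finite G" "G \<subseteq> dual_space X" "0 < \<delta>"
  shows "\<exists>T. ai_operator X \<epsilon> (span B) T \<and> (\<forall>f\<in>G. \<forall>b\<in>B. \<bar>\<psi> (f, b) - f (T b)\<bar> < \<delta>)"
proof -
  define U where "U = (\<Inter>z\<in>G \<times> B. {h :: ('a \<Rightarrow> real) \<times> 'a \<Rightarrow> real. \<bar>\<psi> z - h z\<bar> < \<delta>})"
  have "open U"
    unfolding U_def using assms
    by (intro open_INT finite_cartesian_product ballI open_Collect_less continuous_intros
        continuous_on_product_coordinates)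
  moreover have "\<psi> \<in> U" using \<open>0 < \<delta>\<close> by (simp add: U_def)
  ultimately obtain h where h: "h \<in> evaluations X B \<epsilon>" "h \<in> U"
    using \<psi> unfolding closure_iff_nhds_not_empty by blast
  then obtain T where T: "ai_operator X \<epsilon> (span B) T"
    and hT: "\<forall>f\<in>dual_space X. \<forall>e\<in>span B. h (f, e) = f (T e)"
    unfolding evaluations_def by blast
  have "\<bar>\<psi> (f, b) - f (T b)\<bar> < \<delta>" if "f \<in> G" "b \<in> B" for f b
  proof -
    have "\<bar>\<psi> (f, b) - h (f, b)\<bar> < \<delta>" using h(2) that by (auto simp: U_def)
    then show ?thesis using hT that assms(4) by (auto simp: span_base)
  qed
  then show ?thesis using T by blast
qed

text \<open>Each property of the extension operator involves finitely many coordinates of \<open>\<psi>\<close> and is a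
  closed condition satisfied by the evaluations of all operators defined on the vectors involved;
  only the norm bound needs \<open>\<epsilon>\<close> to tend to 0.\<close>

lemma limit_extension_operator:
  fixes X :: "'a::real_normed_vector set"
  assumes X: "subspace X"
    and \<psi>: "\<And>B \<epsilon>. finite B \<Longrightarrow> 0 < \<epsilon> \<Longrightarrow> \<psi> \<in> closure (evaluations X B \<epsilon>)"
  obtains \<phi> where "hahn_banach_extension_operator X \<phi>"
    and "\<And>f e. f \<in> dual_space X \<Longrightarrow> blinfun_apply (\<phi> f) e = \<psi> (f, e)"
proof -
  have limit: "P \<psi>" if "closed {h. P h}" "finite B" "0 < \<epsilon>"
    and "\<And>h T. ai_operator X \<epsilon> (span B) T \<Longrightarrow>
      (\<And>f e. f \<in> dual_space X \<Longrightarrow> e \<in> span B \<Longrightarrow> h (f, e) = f (T e)) \<Longrightarrow> P h"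
    for P and B :: "'a set" and \<epsilon>
  proof -
    have "evaluations X B \<epsilon> \<subseteq> {h. P h}"
      unfolding evaluations_def using that(4) by blast
    then show ?thesis
      using closure_minimal[OF _ that(1)] \<psi>[OF that(2,3)] by blast
  qed
  note closed_rules = closed_Collect_eq closed_Collect_le continuous_intros
    continuous_on_product_coordinates
  have lin: "linear_on X f" if "f \<in> dual_space X" for f
    using that by (simp add: dual_space_def)
  have add: "\<psi> (f, x + y) = \<psi> (f, x) + \<psi> (f, y)" if f: "f \<in> dual_space X" for f x y
  proof (rule limit[where B = "{x, y}" and \<epsilon> = 1])
    fix h T assume T: "ai_operator X 1 (span {x, y}) T"
      and h: "\<And>f e. f \<in> dual_space X \<Longrightarrow> e \<in> span {x, y} \<Longrightarrow> h (f, e) = f (T e)"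
    have xy: "x \<in> span {x, y}" "y \<in> span {x, y}" by (auto intro: span_base)
    then have "T (x + y) = T x + T y" "T x \<in> X" "T y \<in> X"
      using T unfolding ai_operator_def linear_on_def by auto
    then show "h (f, x + y) = h (f, x) + h (f, y)"
      using h[OF f] xy lin[OF f] by (simp add: span_add linear_on_def)
  qed (auto intro!: closed_rules)
  have scale: "\<psi> (f, c *\<^sub>R x) = c * \<psi> (f, x)" if f: "f \<in> dual_space X" for f x c
  proof (rule limit[where B = "{x}" and \<epsilon> = 1])
    fix h T assume T: "ai_operator X 1 (span {x}) T"
      and h: "\<And>f e. f \<in> dual_space X \<Longrightarrow> e \<in> span {x} \<Longrightarrow> h (f, e) = f (T e)"
    have xy: "x \<in> span {x}" by (auto intro: span_base)
    then have "T (c *\<^sub>R x) = c *\<^sub>R T x" "T x \<in> X"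
      using T unfolding ai_operator_def linear_on_def by auto
    then show "h (f, c *\<^sub>R x) = c * h (f, x)"
      using h[OF f] xy lin[OF f] by (simp add: span_scale linear_on_def)
  qed (auto intro!: closed_rules)
  have bound: "\<bar>\<psi> (f, x)\<bar> \<le> norm x * dual_norm X f" if f: "f \<in> dual_space X" for f x
  proof (rule field_le_epsilon)
    fix d :: real assume d: "0 < d"
    let ?b = "norm x * dual_norm X f"
    \<comment> \<open>The denominator is \<open>?b + 1\<close> because \<open>?b\<close> may be 0.\<close>
    define \<epsilon> where "\<epsilon> = d / (?b + 1)"
    have b: "0 \<le> ?b" using dual_norm_nonneg[OF X f] by simp
    then have \<epsilon>: "0 < \<epsilon>" "\<epsilon> * ?b \<le> d" using d by (auto simp: \<epsilon>_def field_simps)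
    show "\<bar>\<psi> (f, x)\<bar> \<le> ?b + d"
    proof (rule limit[where B = "{x}", OF _ _ \<epsilon>(1)])
      fix h T assume T: "ai_operator X \<epsilon> (span {x}) T"
        and h: "\<And>f e. f \<in> dual_space X \<Longrightarrow> e \<in> span {x} \<Longrightarrow> h (f, e) = f (T e)"
      have x: "x \<in> span {x}" by (auto intro: span_base)
      then have Tx: "T x \<in> X" "norm (T x) \<le> (1 + \<epsilon>) * norm x"
        using T unfolding ai_operator_def by auto
      have "\<bar>f (T x)\<bar> \<le> dual_norm X f * norm (T x)" by (rule dual_norm_bound[OF X f Tx(1)])
      also have "\<dots> \<le> dual_norm X f * ((1 + \<epsilon>) * norm x)"
        by (rule mult_left_mono[OF Tx(2) dual_norm_nonneg[OF X f]])
      also have "\<dots> = ?b + \<epsilon> * ?b" by (simp add: algebra_simps)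
      finally show "\<bar>h (f, x)\<bar> \<le> ?b + d" using h[OF f x] \<epsilon>(2) by simp
    qed (auto intro!: closed_rules)
  qed
  have ext: "\<psi> (f, x) = f x" if f: "f \<in> dual_space X" and x: "x \<in> X" for f x
  proof (rule limit[where B = "{x}" and \<epsilon> = 1])
    fix h T assume T: "ai_operator X 1 (span {x}) T"
      and h: "\<And>f e. f \<in> dual_space X \<Longrightarrow> e \<in> span {x} \<Longrightarrow> h (f, e) = f (T e)"
    have "x \<in> span {x}" by (auto intro: span_base)
    then show "h (f, x) = f x"
      using T h[OF f] x unfolding ai_operator_def by simp
  qed (auto intro!: closed_rules)
  have add_left: "\<psi> (f + g, x) = \<psi> (f, x) + \<psi> (g, x)"
    if f: "f \<in> dual_space X" "g \<in> dual_space X" for f g x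
  proof (rule limit[where B = "{x}" and \<epsilon> = 1])
    fix h T assume h: "\<And>f e. f \<in> dual_space X \<Longrightarrow> e \<in> span {x} \<Longrightarrow> h (f, e) = f (T e)"
    have x: "x \<in> span {x}" by (auto intro: span_base)
    show "h (f + g, x) = h (f, x) + h (g, x)"
      unfolding h[OF f(1) x] h[OF f(2) x] h[OF subspace_add[OF subspace_dual_space f] x]
      by simp
  qed (auto intro!: closed_rules)
  have scale_left: "\<psi> (c *\<^sub>R f, x) = c * \<psi> (f, x)" if f: "f \<in> dual_space X" for c f x
  proof (rule limit[where B = "{x}" and \<epsilon> = 1])
    fix h T assume h: "\<And>f e. f \<in> dual_space X \<Longrightarrow> e \<in> span {x} \<Longrightarrow> h (f, e) = f (T e)"
    have x: "x \<in> span {x}" by (auto intro: span_base)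
    show "h (c *\<^sub>R f, x) = c * h (f, x)"
      unfolding h[OF f x] h[OF subspace_scale[OF subspace_dual_space f] x]
      by (simp add: scaleR_fun_def)
  qed (auto intro!: closed_rules)

  define \<phi> where "\<phi> f = Blinfun (\<lambda>e. \<psi> (f, e))" for f
  have \<phi>: "blinfun_apply (\<phi> f) e = \<psi> (f, e)" if f: "f \<in> dual_space X" for f e
  proof -
    have "bounded_linear (\<lambda>e. \<psi> (f, e))"
      by (rule bounded_linear_intro[where K = "dual_norm X f"])
        (use add[OF f] scale[OF f] bound[OF f] in auto)
    then show ?thesis unfolding \<phi>_def by (simp add: bounded_linear_Blinfun_apply)
  qed
  have "linear_on (dual_space X) \<phi>"
    unfolding linear_on_def
    by (auto intro!: blinfun_eqI simp: \<phi> add_left scale_left blinfun.add_left blinfun.scaleR_left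
        subspace_add[OF subspace_dual_space] subspace_scale[OF subspace_dual_space])
  moreover have "norm (\<phi> f) = dual_norm X f" if f: "f \<in> dual_space X" for f
  proof (rule antisym)
    show "norm (\<phi> f) \<le> dual_norm X f"
      by (rule norm_blinfun_bound[OF dual_norm_nonneg[OF X f]])
        (use bound[OF f] in \<open>simp add: \<phi>[OF f] mult.commute\<close>)
    show "dual_norm X f \<le> norm (\<phi> f)"
    proof (rule dual_norm_least[OF X])
      show "\<bar>f x\<bar> \<le> norm (\<phi> f) * norm x" if "x \<in> X" for x
        using norm_blinfun[of "\<phi> f" x] by (simp add: \<phi>[OF f] ext[OF f that])
    qed simp
  qed
  ultimately have "hahn_banach_extension_operator X \<phi>"
    unfolding hahn_banach_extension_operator_def by (auto simp: \<phi> ext)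
  then show ?thesis using that \<phi> by blast
qed

section \<open>Correcting approximate duality\<close>

text \<open>If \<open>\<phi>\<close> is a pointwise limit of operators from the ideal property, then it is represented
  exactly on finite-dimensional spaces: the error \<open>r f e = \<phi> f e - f (T e)\<close> is linear in \<open>f\<close> and in
  \<open>e\<close>, so interpolation in \<open>F\<close> turns it into an operator \<open>S\<close> with \<open>f (S e) = r f e\<close>, which is added
  to \<open>T\<close>.\<close>

lemma exact_duality_correction:
  fixes X :: "'a::real_normed_vector set"
  assumes X: "subspace X" and \<phi>: "hahn_banach_extension_operator X \<phi>"
    and approx: "\<And>B G \<epsilon> \<delta>. \<lbrakk>finite B; finite G; G \<subseteq> dual_space X; 0 < \<epsilon>; 0 < \<delta>\<rbrakk> \<Longrightarrow>
      \<exists>T. ai_operator X \<epsilon> (span B) T \<and> (\<forall>f\<in>G. \<forall>b\<in>B. \<bar>blinfun_apply (\<phi> f) b - f (T b)\<bar> < \<delta>)"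
    and \<epsilon>: "0 < \<epsilon>" and E: "finite_dim_subspace E"
    and F: "finite_dim_subspace F" "F \<subseteq> dual_space X"
  shows "\<exists>T. ai_operator X \<epsilon> E T \<and> (\<forall>e\<in>E. \<forall>f\<in>F. blinfun_apply (\<phi> f) e = f (T e))"
proof -
  have sF: "subspace F" using F(1) by (simp add: finite_dim_subspace_def)
  have sE: "subspace E" using E by (simp add: finite_dim_subspace_def)
  have lin\<phi>: "linear_on F \<phi>"
    using \<phi> F(2) linear_on_subset unfolding hahn_banach_extension_operator_def by blast
  have ext: "blinfun_apply (\<phi> f) x = f x" if "f \<in> F" "x \<in> X" for f x
    using \<phi> F(2) that unfolding hahn_banach_extension_operator_def by blast
  have linf: "linear_on X f" if "f \<in> F" for f
    using that F(2) by (auto simp: dual_space_def)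
  obtain B where B: "finite B" "B \<subseteq> E" "independent B" "span B = E"
    by (rule finite_dim_subspace_basis[OF E])
  obtain D :: "('a \<Rightarrow> real) set" and p g
    where interp: "finite D \<and> p ` D \<subseteq> X \<and> g ` D \<subseteq> F \<and> (\<forall>f\<in>F. f = (\<Sum>d\<in>D. f (p d) *\<^sub>R g d))"
    using interpolation_in_dual_space[OF X F] by (elim exE) (rule that)
  then have D: "finite D" "\<And>d. d \<in> D \<Longrightarrow> p d \<in> X" "\<And>d. d \<in> D \<Longrightarrow> g d \<in> F" by auto
  have pg: "f = (\<Sum>d\<in>D. f (p d) *\<^sub>R g d)" if "f \<in> F" for f
    using interp that by blast
  obtain K where K: "K > 0" "\<And>c b. b \<in> B \<Longrightarrow> \<bar>c b\<bar> \<le> K * norm (\<Sum>b\<in>B. c b *\<^sub>R b)"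
    using coordinates_bounded[OF B(1,3)] by blast
  \<comment> \<open>If \<open>T\<close> is accurate to \<open>\<eta>\<close> and \<open>S\<close> has norm at most \<open>\<eta>\<close>, then \<open>T + S\<close> stretches norms by
    factors between \<open>inverse (1 + \<eta>) - \<eta> \<ge> 1 - 2 * \<eta>\<close> and \<open>1 + 2 * \<eta>\<close>. This \<open>\<eta>\<close> makes the lower one
    equal to \<open>inverse (1 + \<epsilon>)\<close>.\<close>
  define \<eta> where "\<eta> = \<epsilon> / (2 * (1 + \<epsilon>))"
  have \<eta>: "0 < \<eta>" using \<epsilon> by (simp add: \<eta>_def)
  \<comment> \<open>If the errors at the basis vectors are below \<open>\<delta>\<close>, then \<open>S\<close> has norm at most \<open>\<delta> * W\<close>.\<close>
  define W where "W = K * card B * (\<Sum>d\<in>D. norm (p d))"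
  have W: "0 \<le> W" unfolding W_def using K(1) by (intro mult_nonneg_nonneg sum_nonneg) auto
  define \<delta> where "\<delta> = \<eta> / (W + 1)"
  have \<delta>: "0 < \<delta>" "\<delta> * W \<le> \<eta>" using W \<eta> by (auto simp: \<delta>_def field_simps)
  have "finite (g ` D)" "g ` D \<subseteq> dual_space X" using D F(2) by auto
  then obtain T where "ai_operator X \<eta> (span B) T"
    and close: "\<And>d b. d \<in> D \<Longrightarrow> b \<in> B \<Longrightarrow> \<bar>blinfun_apply (\<phi> (g d)) b - g d (T b)\<bar> < \<delta>"
    using approx[OF B(1) _ _ \<eta> \<delta>(1), of "g ` D"] by blast
  then have T: "linear_on E T" "\<And>e. e \<in> E \<Longrightarrow> T e \<in> X" "\<And>e. e \<in> E \<Longrightarrow> e \<in> X \<Longrightarrow> T e = e"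
    "\<And>e. e \<in> E \<Longrightarrow> inverse (1 + \<eta>) * norm e \<le> norm (T e)"
    "\<And>e. e \<in> E \<Longrightarrow> norm (T e) \<le> (1 + \<eta>) * norm e"
    unfolding ai_operator_def B(4) by auto
  define r where "r f e = blinfun_apply (\<phi> f) e - f (T e)" for f e
  have lin_r: "linear_on E (r f)" if "f \<in> F" for f
    using T(1,2) linf[OF that] sE
    by (auto simp: linear_on_def r_def blinfun.add_right blinfun.scaleR_right subspace_add
        algebra_simps)
  have lin_r': "linear_on F (\<lambda>f. r f e)" for e
    using lin\<phi> unfolding linear_on_def r_def
    by (auto simp: blinfun.add_left blinfun.scaleR_left scaleR_fun_def algebra_simps)
  define S where "S e = (\<Sum>d\<in>D. r (g d) e *\<^sub>R p d)" for e
  have SX: "S e \<in> X" for e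
    unfolding S_def using D(2) by (intro subspace_sum[OF X] subspace_scale[OF X]) auto
  have linS: "linear_on E S"
    unfolding linear_on_def
  proof (intro conjI ballI allI)
    fix x y assume "x \<in> E" "y \<in> E"
    then have "r (g d) (x + y) = r (g d) x + r (g d) y" if "d \<in> D" for d
      using lin_r[OF D(3)[OF that]] by (simp add: linear_on_def)
    then show "S (x + y) = S x + S y"
      by (simp add: S_def scaleR_add_left sum.distrib)
  next
    fix c x assume "x \<in> E"
    then have "r (g d) (c *\<^sub>R x) = c * r (g d) x" if "d \<in> D" for d
      using lin_r[OF D(3)[OF that]] by (simp add: linear_on_def)
    then show "S (c *\<^sub>R x) = c *\<^sub>R S x"
      by (simp add: S_def scaleR_sum_right)
  qed
  have S0: "S e = 0" if "e \<in> E" "e \<in> X" for e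
    unfolding S_def by (rule sum.neutral) (use that D(3) ext T(3) in \<open>auto simp: r_def\<close>)
  have fS: "f (S e) = r f e" if f: "f \<in> F" for f e
  proof -
    have "f (S e) = (\<Sum>d\<in>D. r (g d) e *\<^sub>R f (p d))"
      unfolding S_def by (rule linear_on_sum[OF X linf[OF f] D(2)])
    also have "\<dots> = (\<Sum>d\<in>D. f (p d) *\<^sub>R r (g d) e)" by (simp add: mult.commute)
    also have "\<dots> = r (\<Sum>d\<in>D. f (p d) *\<^sub>R g d) e"
      by (rule linear_on_sum[OF sF lin_r' D(3), symmetric])
    finally show ?thesis by (simp add: pg[OF f, symmetric])
  qed
  have small: "norm (S e) \<le> \<eta> * norm e" if e: "e \<in> E" for e
  proof -
    obtain c where c: "e = (\<Sum>b\<in>B. c b *\<^sub>R b)"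
      using e B(1) unfolding B(4)[symmetric] span_finite[OF B(1)] by auto
    have "\<bar>r (g d) e\<bar> \<le> card B * (K * norm e * \<delta>)" if d: "d \<in> D" for d
    proof -
      have "r (g d) e = (\<Sum>b\<in>B. c b *\<^sub>R r (g d) b)"
        unfolding c by (rule linear_on_sum[OF sE lin_r[OF D(3)[OF d]]]) (use B(2) in auto)
      also have "\<bar>\<dots>\<bar> \<le> (\<Sum>b\<in>B. \<bar>c b *\<^sub>R r (g d) b\<bar>)" by (rule sum_abs)
      also have "\<dots> \<le> (\<Sum>b\<in>B. K * norm e * \<delta>)"
      proof (rule sum_mono)
        fix b assume b: "b \<in> B"
        show "\<bar>c b *\<^sub>R r (g d) b\<bar> \<le> K * norm e * \<delta>"
          using K(2)[OF b, of c] close[OF d b] K(1) \<delta>(1)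
          unfolding c[symmetric] r_def by (auto simp: abs_mult intro!: mult_mono)
      qed
      finally show ?thesis by simp
    qed
    then have "norm (S e) \<le> (\<Sum>d\<in>D. card B * (K * norm e * \<delta>) * norm (p d))"
      unfolding S_def by (intro sum_norm_le) (auto intro: mult_right_mono)
    also have "\<dots> = \<delta> * W * norm e"
      by (simp add: W_def sum_distrib_left[symmetric])
    also have "\<dots> \<le> \<eta> * norm e" using \<delta>(2) by (intro mult_right_mono) auto
    finally show ?thesis .
  qed
  define T' where "T' e = T e + S e" for e
  have "linear_on E T'"
    using T(1) linS by (auto simp: linear_on_def T'_def algebra_simps)
  moreover have "T' ` E \<subseteq> X" "\<forall>e\<in>X \<inter> E. T' e = e"
    using T(2,3) SX S0 by (auto simp: T'_def subspace_add[OF X])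
  moreover have "inverse (1 + \<epsilon>) * norm e \<le> norm (T' e) \<and> norm (T' e) \<le> (1 + \<epsilon>) * norm e"
    if e: "e \<in> E" for e
  proof
    have "inverse (1 + \<epsilon>) = 1 - 2 * \<eta>" using \<epsilon> by (simp add: \<eta>_def field_simps)
    also have "\<dots> \<le> inverse (1 + \<eta>) - \<eta>" using \<eta> by (simp add: field_simps)
    finally have "inverse (1 + \<epsilon>) * norm e \<le> (inverse (1 + \<eta>) - \<eta>) * norm e"
      by (rule mult_right_mono) simp
    also have "\<dots> \<le> norm (T e) - norm (S e)"
      using T(4)[OF e] small[OF e] by (simp add: algebra_simps)
    also have "\<dots> \<le> norm (T' e)"
      unfolding T'_def using norm_diff_ineq by blast
    finally show "inverse (1 + \<epsilon>) * norm e \<le> norm (T' e)" .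
    have "norm (T' e) \<le> norm (T e) + norm (S e)"
      unfolding T'_def by (rule norm_triangle_ineq)
    also have "\<dots> \<le> (1 + 2 * \<eta>) * norm e"
      using T(5)[OF e] small[OF e] by (simp add: algebra_simps)
    also have "\<dots> \<le> (1 + \<epsilon>) * norm e"
      using \<epsilon> by (intro mult_right_mono) (auto simp: \<eta>_def field_simps)
    finally show "norm (T' e) \<le> (1 + \<epsilon>) * norm e" .
  qed
  moreover have "blinfun_apply (\<phi> f) e = f (T' e)" if "e \<in> E" "f \<in> F" for e f
    using linf[OF that(2)] T(2)[OF that(1)] SX[of e] fS[OF that(2), of e]
    by (simp add: T'_def linear_on_def r_def)
  ultimately show ?thesis unfolding ai_operator_def by blast
qed

theorem theorem1p4:
  fixes X :: "'a::banach set"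
  assumes "subspace X" and "ai_ideal X"
  shows "\<exists>\<phi> :: ('a \<Rightarrow> real) \<Rightarrow> 'a \<Rightarrow>\<^sub>L real. hahn_banach_extension_operator X \<phi> \<and>
    (\<forall>\<epsilon>>0. \<forall>E F. finite_dim_subspace E \<and> finite_dim_subspace F \<and> F \<subseteq> dual_space X \<longrightarrow>
      (\<exists>T. linear_on E T \<and> T ` E \<subseteq> X \<and>
        (\<forall>e\<in>X \<inter> E. T e = e) \<and>
        (\<forall>e\<in>E. inverse (1 + \<epsilon>) * norm e \<le> norm (T e) \<and> norm (T e) \<le> (1 + \<epsilon>) * norm e) \<and>
        (\<forall>e\<in>E. \<forall>f\<in>F. blinfun_apply (\<phi> f) e = f (T e))))"
proof -
  obtain \<psi> where \<psi>: "\<And>B \<epsilon>. finite B \<Longrightarrow> 0 < \<epsilon> \<Longrightarrow> \<psi> \<in> closure (evaluations X B \<epsilon>)"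
    using limit_of_evaluations[OF assms(2)] by blast
  obtain \<phi> where \<phi>: "hahn_banach_extension_operator X \<phi>"
    and \<phi>\<psi>: "\<And>f e. f \<in> dual_space X \<Longrightarrow> blinfun_apply (\<phi> f) e = \<psi> (f, e)"
    using limit_extension_operator[OF assms(1) \<psi>] by metis
  have approx: "\<exists>T. ai_operator X \<epsilon> (span B) T \<and>
      (\<forall>f\<in>G. \<forall>b\<in>B. \<bar>blinfun_apply (\<phi> f) b - f (T b)\<bar> < \<delta>)"
    if B: "finite B" "finite G" "G \<subseteq> dual_space X" "0 < \<epsilon>" "0 < \<delta>" for B G \<epsilon> \<delta>
  proof -
    have "\<phi> f b = \<psi> (f, b)" if "f \<in> G" for f b using \<phi>\<psi> that B(3) by blast
    then show ?thesis
      using limit_of_evaluations_approximates[OF \<psi>[OF B(1,4)] B(1-3,5)] by simp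
  qed
  show ?thesis
    using exact_duality_correction[OF assms(1) \<phi> approx] \<phi>
    unfolding ai_operator_def by (intro exI[of _ \<phi>]) (simp only: simp_thms conj_assoc, blast)
qed

end
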